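(* Let $0<\mu<L$ and $(\gamma,\beta)\in\Omega_{\mathrm{cv}}(\mathcal Q_{\mu,L})$. If $\mathrm{HB}_{\gamma,\beta}$ has a cycle on $\mathcal F_{\mu,L}$, then there exist an integer $K\ge2$ and reals $\tilde\nu_1,\dots,\tilde\nu_{\lfloor K/2\rfloor}\ge0$ such that $\mathrm{HB}_{\gamma,\beta}$ cycles on $\mathcal F_{\mu,L}$ on the $K$ points $(x_k)_{0\le k\le K-1}$ of $\mathbb R^{K-1}$ defined blockwise as follows: for every $k\in\{0,\dots,K-1\}$, $x_k$ is the concatenation of the two-dimensional blocks $$\tilde\nu_\ell\begin{pmatrix}\cos\left(k\cdot\frac{2\pi\ell}{K}\right)\\ \sin\left(k\cdot\frac{2\pi\ell}{K}\right)\end{pmatrix},\qquad \ell=1,\dots,\left\lfloor\tfrac{K-1}{2}\right\rfloor,$$ followed, only if $K$ is even, by the one-dimensional block $\tilde\nu_{K/2}\,(-1)^k$.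
   Context: For $0<\mu\le L$, $\mathcal F_{\mu,L}$ is the set of continuously differentiable functions $f:\mathbb R^d\to\mathbb R$ ($d\ge1$ arbitrary) with $f(x)\le f(y)+\langle\nabla f(y),x-y\rangle+\frac L2\|x-y\|^2$ and $f(x)\ge f(y)+\langle\nabla f(y),x-y\rangle+\frac\mu2\|x-y\|^2$ for all $x,y$. For $\gamma,\beta\in\mathbb R$ and differentiable $f$, $\mathrm{HB}_{\gamma,\beta}(f)$ is the iteration $z_{t+1}=z_t-\gamma\nabla f(z_t)+\beta(z_t-z_{t-1})$, $t\ge1$, from initial points $z_0,z_1$. For an integer $K$ and $K$ points $(x_0,\dots,x_{K-1})$ not all equal, $\mathrm{HB}_{\gamma,\beta}(f)$ cycles on $(x_0,\dots,x_{K-1})$ if the sequence initialized at $z_0=x_0,z_1=x_1$ satisfies $z_t=x_{t\bmod K}$ for all $t\ge0$. $\mathrm{HB}_{\gamma,\beta}$ cycles on $(x_0,\dots,x_{K-1})$ on a class $\mathcal F$ if the points are not all equal and there exists $f\in\mathcal F$ such that $\mathrm{HB}_{\gamma,\beta}(f)$ cycles on these points; $\mathrm{HB}_{\gamma,\beta}$ has a cycle on $\mathcal F$ if this holds for some $K$ and some such points. $\Omega_{\mathrm{cv}}(\mathcal Q_{\mu,L})=\{(\gamma,\beta):\beta\in(-1,1),\ 0<\gamma<\frac2L(1+\beta)\}$; throughout, $(\gamma,\beta)$ belongs to this set. *)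

theory Defs
  imports "HOL-Analysis.Analysis" "HOL-Library.More_List"
begin

text \<open>
  The dimension of the space varies inside the statement (it is \<open>K - 1\<close> for an existentially
  quantified \<open>K\<close>), so it cannot be a type. The space \<open>\<real>\<^sup>d\<close> is the carrier of the library
  topology \<open>Euclidean_space d\<close>: sequences of reals that vanish from index \<open>d\<close> on.
  Functions on \<open>\<real>\<^sup>d\<close> are total functions of which only the values on this carrier matter.
\<close>

abbreviation Rn :: "nat \<Rightarrow> (nat \<Rightarrow> real) set" where
  "Rn d \<equiv> topspace (Euclidean_space d)"

definition inner_Rn :: "nat \<Rightarrow> (nat \<Rightarrow> real) \<Rightarrow> (nat \<Rightarrow> real) \<Rightarrow> real" where
  "inner_Rn d u v = (\<Sum>i<d. u i * v i)"

abbreviation norm_Rn :: "nat \<Rightarrow> (nat \<Rightarrow> real) \<Rightarrow> real" where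
  "norm_Rn d u \<equiv> L2_set u {..<d}"

definition has_gradient ::
    "nat \<Rightarrow> ((nat \<Rightarrow> real) \<Rightarrow> real) \<Rightarrow> (nat \<Rightarrow> real) \<Rightarrow> (nat \<Rightarrow> real) \<Rightarrow> bool" where
  "has_gradient d f g x \<longleftrightarrow> x \<in> Rn d \<and> g \<in> Rn d \<and>
     ((\<lambda>y. (f y - f x - inner_Rn d g (\<lambda>i. y i - x i)) / norm_Rn d (\<lambda>i. y i - x i)) \<longlongrightarrow> 0)
       (atin (Euclidean_space d) x)"

definition gradient :: "nat \<Rightarrow> ((nat \<Rightarrow> real) \<Rightarrow> real) \<Rightarrow> (nat \<Rightarrow> real) \<Rightarrow> nat \<Rightarrow> real" where
  "gradient d f x = (THE g. has_gradient d f g x)"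

lemma has_gradient_unique:
  assumes "has_gradient d f g x" "has_gradient d f h x"
  shows "g = h"
proof
  fix i
  have x: "x \<in> Rn d" and gh: "g \<in> Rn d" "h \<in> Rn d"
    using assms by (auto simp: has_gradient_def)
  show "g i = h i"
  proof (cases "i < d")
    case False
    then show ?thesis using gh by (auto simp: topspace_Euclidean_space)
  next
    case True
    define p where "p t j = (if j < d then (if j = i then x j + t else x j) else 0)" for t :: real and j
    have p0: "p 0 = x" using x by (auto simp: p_def topspace_Euclidean_space fun_eq_iff)
    have cont: "continuous_map euclideanreal (Euclidean_space d) p"
      unfolding p_def [abs_def] continuous_map_componentwise_Euclidean_space
      by (auto intro!: continuous_intros)
    have lim: "filterlim p (atin (Euclidean_space d) x) (at_right 0)"
      unfolding filterlim_iff
    proof (intro allI impI)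
      fix P assume "eventually P (atin (Euclidean_space d) x)"
      then obtain T where T: "openin (Euclidean_space d) T" "x \<in> T"
          and P: "\<And>y. y \<in> T \<Longrightarrow> y \<noteq> x \<Longrightarrow> P y"
        using x by (auto simp: eventually_atin)
      have "open {t. p t \<in> T}"
        using openin_continuous_map_preimage [OF cont T(1)] by simp
      moreover have "P (p t)" if "p t \<in> T" "t \<noteq> 0" for t
      proof -
        have "p t i \<noteq> x i" using that True by (simp add: p_def)
        then show ?thesis using P [OF that(1)] by metis
      qed
      ultimately show "\<forall>\<^sub>F t in at_right 0. P (p t)"
        unfolding eventually_at_topological using p0 T(2)
        by (intro exI [of _ "{t. p t \<in> T}"]) auto
    qed
    have diff: "p t j - x j = (if j = i then t else 0)" if "j < d" for t j
      using that by (simp add: p_def)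
    have inn: "inner_Rn d u (\<lambda>j. p t j - x j) = u i * t" for u t
    proof -
      have "inner_Rn d u (\<lambda>j. p t j - x j) = (\<Sum>j<d. if j = i then u j * t else 0)"
        unfolding inner_Rn_def by (intro sum.cong) (auto simp: diff)
      then show ?thesis using True by simp
    qed
    have nrm: "norm_Rn d (\<lambda>j. p t j - x j) = \<bar>t\<bar>" for t
    proof -
      have "norm_Rn d (\<lambda>j. p t j - x j) = sqrt (\<Sum>j<d. if j = i then t\<^sup>2 else 0)"
        unfolding L2_set_def by (intro arg_cong [where f = sqrt] sum.cong) (auto simp: diff)
      then show ?thesis using True by simp
    qed
    have l: "((\<lambda>t. (f (p t) - f x - u i * t) / \<bar>t\<bar>) \<longlongrightarrow> 0) (at_right 0)"
      if "has_gradient d f u x" for u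
      using filterlim_compose [OF _ lim] that
      unfolding has_gradient_def by (fastforce simp: inn nrm)
    have "((\<lambda>t. (f (p t) - f x - g i * t) / \<bar>t\<bar> - (f (p t) - f x - h i * t) / \<bar>t\<bar>)
        \<longlongrightarrow> 0 - 0) (at_right (0::real))"
      by (intro tendsto_diff l assms)
    moreover have "\<forall>\<^sub>F t in at_right (0::real).
        (f (p t) - f x - g i * t) / \<bar>t\<bar> - (f (p t) - f x - h i * t) / \<bar>t\<bar> = h i - g i"
      using eventually_at_right_less [of "0::real"]
      by eventually_elim (simp add: field_simps)
    ultimately have "((\<lambda>t. h i - g i) \<longlongrightarrow> 0) (at_right (0::real))"
      using Lim_transform_eventually by fastforce
    then show ?thesis
      by (simp add: tendsto_const_iff)
  qed
qed

lemma gradient_eq: "has_gradient d f g x \<Longrightarrow> gradient d f x = g"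
  unfolding gradient_def using has_gradient_unique by blast

definition continuously_differentiable :: "nat \<Rightarrow> ((nat \<Rightarrow> real) \<Rightarrow> real) \<Rightarrow> bool" where
  "continuously_differentiable d f \<longleftrightarrow>
     (\<forall>x \<in> Rn d. \<exists>g. has_gradient d f g x) \<and>
     continuous_map (Euclidean_space d) (Euclidean_space d) (gradient d f)"

definition smooth_strongly_convex ::
    "real \<Rightarrow> real \<Rightarrow> nat \<Rightarrow> ((nat \<Rightarrow> real) \<Rightarrow> real) set" where
  "smooth_strongly_convex \<mu> L d =
     {f. continuously_differentiable d f \<and>
         (\<forall>x \<in> Rn d. \<forall>y \<in> Rn d.
            f x \<le> f y + inner_Rn d (gradient d f y) (\<lambda>i. x i - y i)
                    + L / 2 * (norm_Rn d (\<lambda>i. x i - y i))\<^sup>2 \<and>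
            f x \<ge> f y + inner_Rn d (gradient d f y) (\<lambda>i. x i - y i)
                    + \<mu> / 2 * (norm_Rn d (\<lambda>i. x i - y i))\<^sup>2)}"

fun heavy_ball ::
    "real \<Rightarrow> real \<Rightarrow> nat \<Rightarrow> ((nat \<Rightarrow> real) \<Rightarrow> real) \<Rightarrow> (nat \<Rightarrow> real) \<Rightarrow> (nat \<Rightarrow> real) \<Rightarrow>
     nat \<Rightarrow> nat \<Rightarrow> real" where
  "heavy_ball \<gamma> \<beta> d f z0 z1 0 = z0"
| "heavy_ball \<gamma> \<beta> d f z0 z1 (Suc 0) = z1"
| "heavy_ball \<gamma> \<beta> d f z0 z1 (Suc (Suc t)) =
     (\<lambda>i. heavy_ball \<gamma> \<beta> d f z0 z1 (Suc t) i
        - \<gamma> * gradient d f (heavy_ball \<gamma> \<beta> d f z0 z1 (Suc t)) i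
        + \<beta> * (heavy_ball \<gamma> \<beta> d f z0 z1 (Suc t) i - heavy_ball \<gamma> \<beta> d f z0 z1 t i))"

text \<open>Only \<open>x 0, \<dots>, x (K - 1)\<close> matter; that they are not all equal forces \<open>K \<ge> 2\<close>.\<close>

definition HB_fun_cycles_on ::
    "real \<Rightarrow> real \<Rightarrow> nat \<Rightarrow> ((nat \<Rightarrow> real) \<Rightarrow> real) \<Rightarrow> nat \<Rightarrow> (nat \<Rightarrow> nat \<Rightarrow> real) \<Rightarrow> bool" where
  "HB_fun_cycles_on \<gamma> \<beta> d f K x \<longleftrightarrow>
     (\<forall>k<K. x k \<in> Rn d) \<and> (\<exists>j<K. \<exists>k<K. x j \<noteq> x k) \<and>
     (\<forall>t. heavy_ball \<gamma> \<beta> d f (x 0) (x 1) t = x (t mod K))"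

text \<open>
  A function class is a family indexed by the dimension \<open>d\<close>; having a cycle on the class means
  having one in some dimension \<open>d \<ge> 1\<close>.
\<close>

definition HB_cycles_on ::
    "real \<Rightarrow> real \<Rightarrow> (nat \<Rightarrow> ((nat \<Rightarrow> real) \<Rightarrow> real) set) \<Rightarrow> nat \<Rightarrow> nat \<Rightarrow>
     (nat \<Rightarrow> nat \<Rightarrow> real) \<Rightarrow> bool" where
  "HB_cycles_on \<gamma> \<beta> \<F> d K x \<longleftrightarrow> (\<exists>f \<in> \<F> d. HB_fun_cycles_on \<gamma> \<beta> d f K x)"

definition HB_has_cycle ::
    "real \<Rightarrow> real \<Rightarrow> (nat \<Rightarrow> ((nat \<Rightarrow> real) \<Rightarrow> real) set) \<Rightarrow> bool" where
  "HB_has_cycle \<gamma> \<beta> \<F> \<longleftrightarrow> (\<exists>d\<ge>1. \<exists>K x. HB_cycles_on \<gamma> \<beta> \<F> d K x)"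

text \<open>The set \<open>\<Omega>\<^sub>c\<^sub>v(\<Q>\<^sub>\<mu>\<^sub>,\<^sub>L)\<close>; it does not depend on \<open>\<mu>\<close>.\<close>

definition Omega_cv_Q :: "real \<Rightarrow> (real \<times> real) set" where
  "Omega_cv_Q L = {(\<gamma>, \<beta>). \<beta> \<in> {-1<..<1} \<and> 0 < \<gamma> \<and> \<gamma> < 2 / L * (1 + \<beta>)}"

definition block_list :: "nat \<Rightarrow> (nat \<Rightarrow> real) \<Rightarrow> nat \<Rightarrow> real list" where
  "block_list K \<nu> k =
     concat (map (\<lambda>l. [\<nu> l * cos (real k * (2 * pi * real l / real K)),
                       \<nu> l * sin (real k * (2 * pi * real l / real K))])
               [1..<Suc ((K - 1) div 2)])
     @ (if even K then [\<nu> (K div 2) * (-1) ^ k] else [])"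

definition block_point :: "nat \<Rightarrow> (nat \<Rightarrow> real) \<Rightarrow> nat \<Rightarrow> nat \<Rightarrow> real" where
  "block_point K \<nu> k = nth_default 0 (block_list K \<nu> k)"

lemma length_block_list:
  assumes "K \<ge> 1"
  shows "length (block_list K \<nu> k) = K - 1"
proof -
  have "length (concat (map (\<lambda>l. [a l, b l]) xs)) = 2 * length xs" for a b :: "nat \<Rightarrow> real" and xs
    by (induction xs) auto
  then show ?thesis
    using assms by (auto simp: block_list_def simp del: upt_Suc elim!: evenE oddE)
qed

lemma block_point_in_Rn: "K \<ge> 1 \<Longrightarrow> block_point K \<nu> k \<in> Rn (K - 1)"
  by (simp add: block_point_def topspace_Euclidean_space nth_default_beyond length_block_list)

end

theory Submission
  imports Defs
begin

text \<open>
  Let \<open>z\<^sub>t\<close> be a cycle of length \<open>K\<close> for \<open>f\<close>, with mean \<open>c\<close>. Placing the \<open>K\<close> shifts of \<open>z - c\<close> side by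
  side gives a cycle for \<open>U \<mapsto> (\<Sum>s<K. f (c + U s))\<close> on \<open>\<real>\<^bsup>K d\<^esup>\<close>, which is again \<open>\<mu>\<close>-strongly convex and
  \<open>L\<close>-smooth; the Gram matrix of the new cycle is circulant. By discrete Fourier analysis it is the
  Gram matrix of the block points whose squared radii are given by the power spectrum of the cycle.
  Two families of points with the same Gram matrix span isometric spaces, and a function can be
  carried along this isometry together with its gradients on the span. Heavy-ball steps on
  the cycle involve only vectors of the span, so the block points form a cycle as well.
\<close>

section \<open>Inner products, Gram matrices and orthogonal projection\<close>

text \<open>The index type is arbitrary because vectors are indexed by coordinates in one use and by
  pairs of a shift and a coordinate in the other. Only the entries at indices in \<open>I\<close>
  count.\<close>

definition dot :: "'i set \<Rightarrow> ('i \<Rightarrow> real) \<Rightarrow> ('i \<Rightarrow> real) \<Rightarrow> real" where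
  "dot I u v = (\<Sum>i\<in>I. u i * v i)"

definition lincomb :: "nat \<Rightarrow> (nat \<Rightarrow> real) \<Rightarrow> (nat \<Rightarrow> 'i \<Rightarrow> real) \<Rightarrow> 'i \<Rightarrow> real" where
  "lincomb n c X = (\<lambda>i. \<Sum>j<n. c j * X j i)"

lemma inner_Rn_eq_dot: "inner_Rn d u v = dot {..<d} u v"
  by (simp add: inner_Rn_def dot_def)

lemma norm_Rn_power2: "(norm_Rn d u)\<^sup>2 = dot {..<d} u u"
  by (simp add: L2_set_def dot_def sum_nonneg power2_eq_square)

lemma dot_commute: "dot I u v = dot I v u"
  by (simp add: dot_def mult.commute)

lemma dot_add_left: "dot I (\<lambda>i. u i + v i) w = dot I u w + dot I v w"
  by (simp add: dot_def algebra_simps sum.distrib)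

lemma dot_add_right: "dot I w (\<lambda>i. u i + v i) = dot I w u + dot I w v"
  by (simp add: dot_def algebra_simps sum.distrib)

lemma dot_diff_left: "dot I (\<lambda>i. u i - v i) w = dot I u w - dot I v w"
  by (simp add: dot_def algebra_simps sum_subtractf)

lemma dot_diff_right: "dot I w (\<lambda>i. u i - v i) = dot I w u - dot I w v"
  by (simp add: dot_def algebra_simps sum_subtractf)

lemma dot_scale_left: "dot I (\<lambda>i. c * u i) w = c * dot I u w"
  by (simp add: dot_def sum_distrib_left mult.assoc)

lemma dot_scale_right: "dot I w (\<lambda>i. c * u i) = c * dot I w u"
  by (simp add: dot_def sum_distrib_left algebra_simps)

lemmas dot_linear = dot_add_left dot_add_right dot_diff_left dot_diff_right
  dot_scale_left dot_scale_right

lemma dot_lincomb_left: "dot I (lincomb n c X) v = (\<Sum>j<n. c j * dot I (X j) v)"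
  unfolding dot_def lincomb_def sum_distrib_left sum_distrib_right
  by (subst sum.swap) (simp add: mult.assoc)

lemma dot_lincomb_right: "dot I v (lincomb n c X) = (\<Sum>j<n. c j * dot I v (X j))"
  by (simp add: dot_commute [of I v] dot_lincomb_left)

lemma dot_self_nonneg: "0 \<le> dot I u u"
  by (simp add: dot_def sum_nonneg)

lemma dot_self_eq_0_iff: "finite I \<Longrightarrow> dot I u u = 0 \<longleftrightarrow> (\<forall>i\<in>I. u i = 0)"
  by (simp add: dot_def sum_nonneg_eq_0_iff)

lemma dot_cong: "(\<And>i. i \<in> I \<Longrightarrow> u i = u' i) \<Longrightarrow> (\<And>i. i \<in> I \<Longrightarrow> v i = v' i) \<Longrightarrow> dot I u v = dot I u' v'"
  by (simp add: dot_def)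

lemma lincomb_diff: "(\<lambda>i. lincomb n c X i - lincomb n c' X i) = lincomb n (\<lambda>j. c j - c' j) X"
  by (simp add: lincomb_def algebra_simps sum_subtractf fun_eq_iff)

lemma lincomb_Suc: "lincomb (Suc n) c X = (\<lambda>i. lincomb n c X i + c n * X n i)"
  by (simp add: lincomb_def fun_eq_iff)

lemma lincomb_indicator: "k < n \<Longrightarrow> lincomb n (\<lambda>j. if j = k then 1 else 0) X = X k"
  by (simp add: lincomb_def fun_eq_iff if_distrib [of "\<lambda>c. c * _"] cong: if_cong)

lemma lincomb_in_Rn: "(\<And>j. j < n \<Longrightarrow> X j \<in> Rn d) \<Longrightarrow> lincomb n c X \<in> Rn d"
  by (simp add: topspace_Euclidean_space lincomb_def)

text \<open>Both sides expand to the same bilinear form in the coefficients. So equal Gram matrices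
  make \<open>lincomb n c X\<close> and \<open>lincomb n c Y\<close> correspond isometrically, even
  if the families are linearly dependent.\<close>

lemma dot_lincomb_gram:
  assumes "\<And>a b. a < n \<Longrightarrow> b < n \<Longrightarrow> dot I (X a) (X b) = dot J (Y a) (Y b)"
  shows "dot I (lincomb n c X) (lincomb n c' X) = dot J (lincomb n c Y) (lincomb n c' Y)"
  by (simp add: dot_lincomb_left dot_lincomb_right assms)

text \<open>Gram-Schmidt by induction on \<open>n\<close>: remove from \<open>v\<close> its
  projection onto the first \<open>n\<close> vectors, then its component along the part
  \<open>e\<close> of \<open>X n\<close> orthogonal to them. The vectors may be linearly dependent,
  so the coefficients need not be unique.\<close>

lemma exists_orthogonal_projection:
  fixes X :: "nat \<Rightarrow> 'i \<Rightarrow> real"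
  assumes "finite I"
  shows "\<exists>c. \<forall>k<n. dot I (\<lambda>i. v i - lincomb n c X i) (X k) = 0"
proof (induction n arbitrary: v)
  case (Suc n)
  obtain c where c: "\<And>k. k < n \<Longrightarrow> dot I (\<lambda>i. v i - lincomb n c X i) (X k) = 0"
    using Suc.IH [of v] by blast
  obtain a where a: "\<And>k. k < n \<Longrightarrow> dot I (\<lambda>i. X n i - lincomb n a X i) (X k) = 0"
    using Suc.IH [of "X n"] by blast
  define r where "r i = v i - lincomb n c X i" for i
  define e where "e i = X n i - lincomb n a X i" for i
  have Xn: "X n = (\<lambda>i. e i + lincomb n a X i)" by (simp add: e_def)
  have r0: "dot I r (X k) = 0" and e0: "dot I e (X k) = 0" if "k < n" for k
    using a [OF that] c [OF that] by (simp_all add: r_def [abs_def] e_def [abs_def])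
  define t where "t = dot I r e / dot I e e"
  \<comment> \<open>Writing \<open>e\<close> out as \<open>X n - lincomb n a X\<close> turns the
    projection of \<open>v\<close> onto the first \<open>n\<close> vectors plus \<open>t\<close>
    times \<open>e\<close> into a combination with these coefficients.\<close>
  define c' where "c' j = (if j < n then c j - t * a j else t)" for j
  have eq: "(\<lambda>i. v i - lincomb (Suc n) c' X i) = (\<lambda>i. r i - t * e i)"
    unfolding lincomb_Suc
    by (simp add: r_def e_def lincomb_def c'_def fun_eq_iff algebra_simps sum_subtractf
        sum_distrib_left)
  \<comment> \<open>In the degenerate case division by zero gives \<open>t = 0\<close>, and the
    equation survives because \<open>e\<close> then vanishes on \<open>I\<close>.\<close>
  have te: "dot I r e = t * dot I e e"
  proof (cases "dot I e e = 0")
    case True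
    then have "\<forall>i\<in>I. e i = 0" using assms by (simp add: dot_self_eq_0_iff)
    then have "dot I r e = 0" by (simp add: dot_def)
    with True show ?thesis by simp
  qed (simp add: t_def)
  have "dot I (\<lambda>i. r i - t * e i) (X k) = 0" if "k < Suc n" for k
  proof (cases "k = n")
    case True
    have "dot I r (X n) = dot I r e" "dot I e (X n) = dot I e e"
      by (subst Xn; simp add: dot_add_right dot_lincomb_right r0 e0)+
    then show ?thesis using True te by (simp add: dot_linear)
  next
    case False
    then show ?thesis using that r0 e0 by (simp add: dot_linear)
  qed
  then show ?case by (intro exI [of _ c']) (simp add: eq)
qed auto

section \<open>Smooth strongly convex functions from quadratic bounds\<close>

lemma continuous_map_norm_Rn_diff:
  "continuous_map (Euclidean_space d) euclideanreal (\<lambda>y. norm_Rn d (\<lambda>i. y i - x i))"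
  unfolding L2_set_def
  by (intro continuous_map_sqrt continuous_map_sum continuous_map_real_pow continuous_map_diff)
     (auto simp: Euclidean_space_def intro!: continuous_map_from_subtopology continuous_map_product_projection)

lemma tendsto_norm_Rn_diff:
  assumes "x \<in> Rn d"
  shows "((\<lambda>y. norm_Rn d (\<lambda>i. y i - x i)) \<longlongrightarrow> 0) (atin (Euclidean_space d) x)"
  using continuous_map_norm_Rn_diff [of d x] assms
  unfolding continuous_map_atin limitin_canonical_iff
  by (fastforce simp: L2_set_def)

text \<open>Cocoercivity: compare the two bounds at \<open>y - (G y - G x) / L\<close>.\<close>

lemma gradient_Lipschitz:
  assumes "0 < L" and G: "\<And>x. x \<in> Rn d \<Longrightarrow> G x \<in> Rn d"
    and upper: "\<And>x y. x \<in> Rn d \<Longrightarrow> y \<in> Rn d \<Longrightarrow>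
      f x \<le> f y + dot {..<d} (G y) (\<lambda>i. x i - y i) + L / 2 * dot {..<d} (\<lambda>i. x i - y i) (\<lambda>i. x i - y i)"
    and lower: "\<And>x y. x \<in> Rn d \<Longrightarrow> y \<in> Rn d \<Longrightarrow>
      f x \<ge> f y + dot {..<d} (G y) (\<lambda>i. x i - y i)"
    and x: "x \<in> Rn d" and y: "y \<in> Rn d"
  shows "norm_Rn d (\<lambda>i. G y i - G x i) \<le> L * norm_Rn d (\<lambda>i. y i - x i)"
proof -
  define w where "w i = G y i - G x i" for i
  define h where "h i = y i - x i" for i
  define z where "z i = y i - (1 / L) * w i" for i
  have z: "z \<in> Rn d"
    using G [OF x] G [OF y] y by (simp add: topspace_Euclidean_space z_def w_def)
  have zy: "(\<lambda>i. z i - y i) = (\<lambda>i. (- 1 / L) * w i)"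
    and zx: "(\<lambda>i. z i - x i) = (\<lambda>i. h i - (1 / L) * w i)"
    by (auto simp: z_def h_def fun_eq_iff)
  have ww: "dot {..<d} w w = dot {..<d} (G y) w - dot {..<d} (G x) w"
    using dot_diff_left [of "{..<d}" "G y" "G x" w] by (simp add: w_def [abs_def])
  have 1: "f z \<le> f y - 1 / L * dot {..<d} (G y) w + 1 / (2 * L) * dot {..<d} w w"
    using upper [OF z y] \<open>0 < L\<close> unfolding zy dot_scale_left dot_scale_right
    by (simp add: power2_eq_square divide_simps)
  have 2: "f z \<ge> f x + dot {..<d} (G x) h - 1 / L * dot {..<d} (G x) w"
    using lower [OF z x] unfolding zx dot_diff_right dot_scale_right by simp
  have 3: "f y \<le> f x + dot {..<d} (G x) h + L / 2 * dot {..<d} h h"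
    using upper [OF y x] by (simp add: h_def [abs_def])
  have "1 / L * dot {..<d} w w = 1 / L * dot {..<d} (G y) w - 1 / L * dot {..<d} (G x) w"
    by (simp add: ww right_diff_distrib)
  moreover have "1 / L * dot {..<d} w w = 2 * (1 / (2 * L) * dot {..<d} w w)"
    using \<open>0 < L\<close> by simp
  \<comment> \<open>Facts \<open>1\<close> and \<open>2\<close> enclose \<open>f z\<close>, and
    \<open>3\<close> eliminates \<open>f y\<close>. The terms linear in \<open>h\<close> cancel and
    those linear in \<open>w\<close> combine to a multiple of \<open>dot {..<d} w w\<close>.\<close>
  ultimately have "1 / (2 * L) * dot {..<d} w w \<le> L / 2 * dot {..<d} h h"
    using 1 2 3 by linarith
  then have "dot {..<d} w w \<le> L\<^sup>2 * dot {..<d} h h"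
    using \<open>0 < L\<close> by (simp add: field_simps power2_eq_square)
  then have "(norm_Rn d w)\<^sup>2 \<le> (L * norm_Rn d h)\<^sup>2"
    by (simp add: norm_Rn_power2 power_mult_distrib)
  then show ?thesis
    unfolding w_def [abs_def] h_def [abs_def]
    using \<open>0 < L\<close> by (meson L2_set_nonneg less_imp_le mult_nonneg_nonneg power2_le_imp_le)
qed

text \<open>The bounds enclose the first-order remainder between \<open>0\<close> and
  \<open>L / 2\<close> times the squared distance, so \<open>G\<close> must be the gradient; it is
  continuous because it is Lipschitz. Membership in the class can thus be proved without
  differentiating anything.\<close>

lemma smooth_strongly_convexI:
  assumes "0 \<le> \<mu>" "0 < L" and G: "\<And>x. x \<in> Rn d \<Longrightarrow> G x \<in> Rn d"
    and upper: "\<And>x y. x \<in> Rn d \<Longrightarrow> y \<in> Rn d \<Longrightarrow>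
      f x \<le> f y + dot {..<d} (G y) (\<lambda>i. x i - y i) + L / 2 * dot {..<d} (\<lambda>i. x i - y i) (\<lambda>i. x i - y i)"
    and lower: "\<And>x y. x \<in> Rn d \<Longrightarrow> y \<in> Rn d \<Longrightarrow>
      f x \<ge> f y + dot {..<d} (G y) (\<lambda>i. x i - y i) + \<mu> / 2 * dot {..<d} (\<lambda>i. x i - y i) (\<lambda>i. x i - y i)"
  shows "f \<in> smooth_strongly_convex \<mu> L d" and "\<And>x. x \<in> Rn d \<Longrightarrow> gradient d f x = G x"
proof -
  have lower0: "f x \<ge> f y + dot {..<d} (G y) (\<lambda>i. x i - y i)" if "x \<in> Rn d" "y \<in> Rn d" for x y
  proof -
    have "0 \<le> \<mu> / 2 * dot {..<d} (\<lambda>i. x i - y i) (\<lambda>i. x i - y i)"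
      using \<open>0 \<le> \<mu>\<close> dot_self_nonneg by (metis divide_nonneg_nonneg mult_nonneg_nonneg zero_le_numeral)
    then show ?thesis using lower [OF that] by linarith
  qed
  have grad: "has_gradient d f (G x) x" if x: "x \<in> Rn d" for x
  proof -
    let ?N = "\<lambda>y. norm_Rn d (\<lambda>i. y i - x i)"
    let ?q = "\<lambda>y. (f y - f x - inner_Rn d (G x) (\<lambda>i. y i - x i)) / ?N y"
    have bound: "\<bar>e / N\<bar> \<le> L / 2 * N" if "0 \<le> e" "e \<le> L / 2 * N\<^sup>2" "0 \<le> N" for e N :: real
    proof (cases "N = 0")
      case False
      then show ?thesis
        using that by (simp add: abs_of_nonneg divide_le_eq power2_eq_square mult.assoc)
    qed simp
    have "\<forall>\<^sub>F y in atin (Euclidean_space d) x. norm (?q y) \<le> L / 2 * ?N y"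
      unfolding eventually_atin
    proof (intro disjI2 exI conjI ballI impI)
      show "openin (Euclidean_space d) (Rn d)" by simp
      show "x \<in> Rn d" by (fact x)
      fix y assume "y \<in> Rn d - {x}"
      then have y: "y \<in> Rn d" by simp
      let ?e = "f y - f x - inner_Rn d (G x) (\<lambda>i. y i - x i)"
      have "?e \<le> L / 2 * (?N y)\<^sup>2" "0 \<le> ?e"
        using upper [OF y x] lower0 [OF y x] by (simp_all add: norm_Rn_power2 inner_Rn_eq_dot)
      then show "norm (?q y) \<le> L / 2 * ?N y"
        unfolding real_norm_def by (intro bound L2_set_nonneg)
    qed
    moreover have "((\<lambda>y. L / 2 * ?N y) \<longlongrightarrow> 0) (atin (Euclidean_space d) x)"
      using tendsto_mult_right_zero [OF tendsto_norm_Rn_diff [OF x]] .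
    ultimately have "(?q \<longlongrightarrow> 0) (atin (Euclidean_space d) x)"
      by (rule Lim_null_comparison)
    then show ?thesis by (simp add: has_gradient_def x G)
  qed
  then show eq: "gradient d f x = G x" if "x \<in> Rn d" for x
    using that gradient_eq by blast
  have "continuous_map (Euclidean_space d) (Euclidean_space d) G"
  proof -
    have "continuous_map (Euclidean_space d) euclideanreal (\<lambda>x. G x i)" if "i < d" for i
      unfolding continuous_map_atin limitin_canonical_iff
    proof
      fix x assume x: "x \<in> Rn d"
      let ?N = "\<lambda>y. norm_Rn d (\<lambda>i. y i - x i)"
      have "\<forall>\<^sub>F y in atin (Euclidean_space d) x. norm (G y i - G x i) \<le> L * ?N y"
        unfolding eventually_atin
      proof (intro disjI2 exI conjI ballI impI)
        show "openin (Euclidean_space d) (Rn d)" by simp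
        show "x \<in> Rn d" by (fact x)
        fix y assume "y \<in> Rn d - {x}"
        then have y: "y \<in> Rn d" by simp
        have "\<bar>G y i - G x i\<bar> \<le> norm_Rn d (\<lambda>i. G y i - G x i)"
          using member_le_L2_set [of "{..<d}" i "\<lambda>i. \<bar>G y i - G x i\<bar>"] that
          by (simp add: L2_set_def)
        also have "\<dots> \<le> L * ?N y"
          using gradient_Lipschitz [OF \<open>0 < L\<close> G upper lower0 x y] .
        finally show "norm (G y i - G x i) \<le> L * ?N y" by simp
      qed
      moreover have "((\<lambda>y. L * ?N y) \<longlongrightarrow> 0) (atin (Euclidean_space d) x)"
        using tendsto_mult_right_zero [OF tendsto_norm_Rn_diff [OF x]] .
      ultimately have "((\<lambda>y. G y i - G x i) \<longlongrightarrow> 0) (atin (Euclidean_space d) x)"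
        by (rule Lim_null_comparison)
      then show "((\<lambda>y. G y i) \<longlongrightarrow> G x i) (atin (Euclidean_space d) x)"
        by (simp add: LIM_zero_iff)
    qed
    then have "continuous_map (Euclidean_space d) (Euclidean_space d) (\<lambda>x i. if i < d then G x i else 0)"
      by (simp add: continuous_map_componentwise_Euclidean_space)
    then show ?thesis
      by (rule continuous_map_eq) (use G in \<open>auto simp: topspace_Euclidean_space fun_eq_iff\<close>)
  qed
  then have "continuous_map (Euclidean_space d) (Euclidean_space d) (gradient d f)"
    by (rule continuous_map_eq) (simp add: eq)
  then show "f \<in> smooth_strongly_convex \<mu> L d"
    unfolding smooth_strongly_convex_def continuously_differentiable_def
    using grad upper lower by (auto simp: eq inner_Rn_eq_dot norm_Rn_power2)
qed

section \<open>Carrying a function between spans with equal Gram matrices\<close>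

text \<open>
  The linear isometry between the two spans is not built from bases: a point \<open>y\<close> is projected onto
  the span of the \<open>Y j\<close>, the coefficients are reused with the \<open>X j\<close>, and the orthogonal component of
  \<open>y\<close> is penalised by \<open>\<mu> / 2\<close> times its squared norm.
\<close>

lemma smooth_strongly_convex_transfer:
  fixes X :: "nat \<Rightarrow> 'i \<Rightarrow> real" and Y :: "nat \<Rightarrow> nat \<Rightarrow> real" and F :: "('i \<Rightarrow> real) \<Rightarrow> real"
  assumes "finite I" and "0 \<le> \<mu>" "0 < L" "\<mu> \<le> L"
    and Y: "\<And>j. j < n \<Longrightarrow> Y j \<in> Rn m"
    and gram: "\<And>a b. a < n \<Longrightarrow> b < n \<Longrightarrow> dot I (X a) (X b) = dot {..<m} (Y a) (Y b)"
    and cong: "\<And>u v. (\<And>i. i \<in> I \<Longrightarrow> u i = v i) \<Longrightarrow> (\<And>i. i \<in> I \<Longrightarrow> G u i = G v i)"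
    and upper: "\<And>u v. F u \<le> F v + dot I (G v) (\<lambda>i. u i - v i)
        + L / 2 * dot I (\<lambda>i. u i - v i) (\<lambda>i. u i - v i)"
    and lower: "\<And>u v. F u \<ge> F v + dot I (G v) (\<lambda>i. u i - v i)
        + \<mu> / 2 * dot I (\<lambda>i. u i - v i) (\<lambda>i. u i - v i)"
  obtains f where "f \<in> smooth_strongly_convex \<mu> L m"
    "\<And>k c. k < n \<Longrightarrow> (\<And>i. i \<in> I \<Longrightarrow> G (X k) i = lincomb n c X i) \<Longrightarrow>
       gradient m f (Y k) = lincomb n c Y"
proof -
  let ?J = "{..<m}"
  have "\<forall>y. \<exists>c. \<forall>k<n. dot ?J (\<lambda>i. y i - lincomb n c Y i) (Y k) = 0"
    by (simp add: exists_orthogonal_projection)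
  then obtain p where p: "\<And>y k. k < n \<Longrightarrow> dot ?J (\<lambda>i. y i - lincomb n (p y) Y i) (Y k) = 0"
    by metis
  have "\<forall>u. \<exists>c. \<forall>k<n. dot I (\<lambda>i. u i - lincomb n c X i) (X k) = 0"
    using \<open>finite I\<close> by (simp add: exists_orthogonal_projection)
  then obtain q where q: "\<And>u k. k < n \<Longrightarrow> dot I (\<lambda>i. u i - lincomb n (q u) X i) (X k) = 0"
    by metis
  define r where "r y = (\<lambda>i. y i - lincomb n (p y) Y i)" for y
  define T where "T y = lincomb n (p y) X" for y
  define f where "f y = F (T y) + \<mu> / 2 * dot ?J (r y) (r y)" for y
  \<comment> \<open>The candidate for the gradient of \<open>f\<close>. The component of
    \<open>G (T y)\<close> in the span of the \<open>X j\<close> is carried back to the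
    \<open>Y j\<close>; its orthogonal component has no effect, as \<open>T\<close> only takes
    values in that span. The summand \<open>\<mu> * r y\<close> is the gradient of the
    penalty.\<close>
  define H where "H y = (\<lambda>i. lincomb n (q (G (T y))) Y i + \<mu> * r y i)" for y
  have r0: "dot ?J (r y) (lincomb n c Y) = 0" for y c
    using p by (simp add: r_def dot_lincomb_right)
  have q0: "dot I u (lincomb n c X) = dot I (lincomb n (q u) X) (lincomb n c X)" for u c
  proof -
    have "dot I (\<lambda>i. u i - lincomb n (q u) X i) (lincomb n c X) = 0"
      using q by (simp add: dot_lincomb_right)
    then show ?thesis by (simp add: dot_diff_left)
  qed
  note gram' = dot_lincomb_gram [of n I X ?J Y, OF gram]
  have H: "H y \<in> Rn m" if "y \<in> Rn m" for y
    using that Y lincomb_in_Rn [of n Y m] by (simp add: topspace_Euclidean_space H_def r_def)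
  \<comment> \<open>Here \<open>u = T x\<close> and \<open>v = T y\<close>, and \<open>a\<close> is
    the squared norm of the orthogonal component of \<open>x - y\<close>. Remainder and squared
    distance split in parallel, so the bounds for \<open>F\<close> pass to \<open>f\<close>; the
    upper one uses \<open>\<mu> \<le> L\<close> on the term with \<open>a\<close>.\<close>
  have key: "\<exists>a\<ge>0. \<exists>u v. f x - f y - dot ?J (H y) (\<lambda>i. x i - y i)
        = F u - F v - dot I (G v) (\<lambda>i. u i - v i) + \<mu> / 2 * a
      \<and> dot ?J (\<lambda>i. x i - y i) (\<lambda>i. x i - y i) = dot I (\<lambda>i. u i - v i) (\<lambda>i. u i - v i) + a"
    for x y
  proof -
    define c where "c j = p x j - p y j" for j
    define s where "s i = r x i - r y i" for i
    have T: "(\<lambda>i. T x i - T y i) = lincomb n c X"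
      by (simp add: T_def lincomb_diff c_def [abs_def])
    have xy: "(\<lambda>i. x i - y i) = (\<lambda>i. lincomb n c Y i + s i)"
      by (simp add: fun_eq_iff s_def r_def c_def [abs_def] flip: lincomb_diff)
    have s0: "dot ?J s (lincomb n a Y) = 0" for a
      using r0 unfolding s_def [abs_def] by (simp add: dot_diff_left)
    then have s0': "dot ?J (lincomb n a Y) s = 0" for a
      by (simp add: dot_commute [of _ _ s])
    have 1: "dot ?J (\<lambda>i. x i - y i) (\<lambda>i. x i - y i)
        = dot I (lincomb n c X) (lincomb n c X) + dot ?J s s"
      unfolding xy by (simp add: dot_linear s0 s0' gram')
    have 2: "dot ?J (H y) (\<lambda>i. x i - y i) = dot I (G (T y)) (lincomb n c X) + \<mu> * dot ?J (r y) s"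
      unfolding xy H_def by (simp add: dot_linear s0' r0 flip: gram' q0)
    have 3: "dot ?J (r x) (r x) - dot ?J (r y) (r y) = 2 * dot ?J (r y) s + dot ?J s s"
      unfolding s_def [abs_def] by (simp add: dot_linear dot_commute [of ?J "r y" "r x"])
    have "f x - f y - dot ?J (H y) (\<lambda>i. x i - y i)
        = F (T x) - F (T y) - dot I (G (T y)) (lincomb n c X) + \<mu> / 2 * dot ?J s s"
    proof -
      have "f x - f y = F (T x) - F (T y) + \<mu> / 2 * (2 * dot ?J (r y) s + dot ?J s s)"
        unfolding f_def 3 [symmetric] by (simp add: right_diff_distrib)
      then show ?thesis unfolding 2 by (simp add: algebra_simps)
    qed
    with 1 show ?thesis
      using dot_self_nonneg [of ?J s] unfolding T [symmetric] by blast
  qed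
  have up: "f x \<le> f y + dot ?J (H y) (\<lambda>i. x i - y i) + L / 2 * dot ?J (\<lambda>i. x i - y i) (\<lambda>i. x i - y i)"
    for x y
  proof -
    obtain a u v where a: "a \<ge> 0" and uv: "f x - f y - dot ?J (H y) (\<lambda>i. x i - y i)
        = F u - F v - dot I (G v) (\<lambda>i. u i - v i) + \<mu> / 2 * a"
      "dot ?J (\<lambda>i. x i - y i) (\<lambda>i. x i - y i) = dot I (\<lambda>i. u i - v i) (\<lambda>i. u i - v i) + a"
      using key [of x y] by blast
    have "\<mu> / 2 * a \<le> L / 2 * a" using a \<open>\<mu> \<le> L\<close> by (simp add: mult_right_mono)
    then show ?thesis using uv upper [of u v] by (simp add: distrib_left)
  qed
  have lo: "f x \<ge> f y + dot ?J (H y) (\<lambda>i. x i - y i) + \<mu> / 2 * dot ?J (\<lambda>i. x i - y i) (\<lambda>i. x i - y i)"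
    for x y
  proof -
    obtain a u v where uv: "f x - f y - dot ?J (H y) (\<lambda>i. x i - y i)
        = F u - F v - dot I (G v) (\<lambda>i. u i - v i) + \<mu> / 2 * a"
      "dot ?J (\<lambda>i. x i - y i) (\<lambda>i. x i - y i) = dot I (\<lambda>i. u i - v i) (\<lambda>i. u i - v i) + a"
      using key [of x y] by blast
    then show ?thesis using lower [of v u] by (simp add: distrib_left)
  qed
  note ssc = smooth_strongly_convexI [OF \<open>0 \<le> \<mu>\<close> \<open>0 < L\<close> H up lo]
  have "gradient m f (Y k) = lincomb n c Y"
    if k: "k < n" and c: "\<And>i. i \<in> I \<Longrightarrow> G (X k) i = lincomb n c X i" for k c
  proof -
    define b where "b j = (if j = k then 1 else 0 :: real) - p (Y k) j" for j
    have bY: "r (Y k) = lincomb n b Y"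
      using k by (simp add: r_def b_def [abs_def] lincomb_indicator flip: lincomb_diff)
    have bX: "(\<lambda>i. X k i - T (Y k) i) = lincomb n b X"
      using k by (simp add: T_def b_def [abs_def] lincomb_indicator flip: lincomb_diff)
    have rr: "dot ?J (lincomb n b Y) (lincomb n b Y) = 0"
      using r0 [of "Y k" b] by (simp add: bY)
    then have r: "r (Y k) i = 0" if "i < m" for i
      using that unfolding bY by (simp add: dot_self_eq_0_iff)
    have "\<forall>i\<in>I. X k i - T (Y k) i = 0"
      using rr \<open>finite I\<close> by (simp add: dot_self_eq_0_iff bX fun_cong [OF bX] flip: gram')
    then have G: "G (T (Y k)) i = lincomb n c X i" if "i \<in> I" for i
      using cong [of "X k" "T (Y k)" i] c that by simp
    let ?q = "q (G (T (Y k)))"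
    \<comment> \<open>The same argument for the gradient: \<open>c\<close> and \<open>?q\<close> may
      differ as coefficients, but their difference represents zero in the span of the
      \<open>X j\<close> and therefore in that of the \<open>Y j\<close>.\<close>
    define a where "a j = c j - ?q j" for j
    have "dot I (G (T (Y k))) (lincomb n a X) = dot I (lincomb n c X) (lincomb n a X)"
      by (rule dot_cong) (auto simp: G)
    then have "dot I (\<lambda>i. lincomb n c X i - lincomb n ?q X i) (lincomb n a X) = 0"
      by (simp add: dot_diff_left q0 [of "G (T (Y k))"])
    then have "dot ?J (lincomb n a Y) (lincomb n a Y) = 0"
      by (simp add: lincomb_diff gram' flip: a_def)
    then have "lincomb n c Y i = lincomb n ?q Y i" if "i < m" for i
      using that fun_cong [OF lincomb_diff [of n c Y ?q], of i]
      by (simp add: dot_self_eq_0_iff flip: a_def)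
    then have "H (Y k) i = lincomb n c Y i" if "i < m" for i
      using that r by (simp add: H_def)
    moreover have "H (Y k) \<in> Rn m" "lincomb n c Y \<in> Rn m"
      using H Y k lincomb_in_Rn [of n Y m] by auto
    ultimately have "H (Y k) = lincomb n c Y"
      by (auto simp: topspace_Euclidean_space fun_eq_iff) (metis leI)
    then show ?thesis using ssc(2) Y k by simp
  qed
  then show thesis using that ssc(1) by blast
qed

section \<open>Discrete Fourier analysis of periodic sequences\<close>

text \<open>The sum is the real part of a geometric series in the root of unity
  \<open>w = cis (2 * pi * n / K)\<close>, and \<open>w = 1\<close> exactly when \<open>K\<close>
  divides \<open>n\<close>.\<close>

lemma sum_cos_multiples:
  fixes n :: int
  assumes "K > 0"
  shows "(\<Sum>l<K. cos (2 * pi * real l * of_int n / real K)) = (if int K dvd n then real K else 0)"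
proof -
  define w where "w = cis (2 * pi * of_int n / real K)"
  have wl: "w ^ l = cis (2 * pi * real l * of_int n / real K)" for l
    by (simp add: w_def Complex.DeMoivre mult_ac)
  have "w ^ K = cis (2 * pi * of_int n)"
    using assms by (simp add: wl mult.assoc del: cis_multiple_2pi)
  also have "\<dots> = 1" by (simp add: cis_multiple_2pi)
  finally have wK: "w ^ K = 1" .
  have w1: "w = 1 \<longleftrightarrow> int K dvd n"
  proof
    assume "w = 1"
    then have "cos (2 * pi * of_int n / real K) = 1" by (simp add: w_def complex_eq_iff)
    then obtain j :: int where "2 * pi * of_int n / real K = of_int j * 2 * pi"
      using cos_one_2pi_int by blast
    then have "real_of_int n = of_int (j * int K)" using assms by (simp add: field_simps)
    then show "int K dvd n" unfolding of_int_eq_iff by simp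
  next
    assume "int K dvd n"
    then obtain j where "n = int K * j" by blast
    then have "w = cis (2 * pi * of_int j)"
      using assms by (simp add: w_def mult.assoc del: cis_multiple_2pi)
    then show "w = 1" by (simp add: cis_multiple_2pi)
  qed
  have "(\<Sum>l<K. w ^ l) = (if int K dvd n then of_nat K else 0)"
    using wK w1 by (auto simp: geometric_sum)
  then have "Re (\<Sum>l<K. w ^ l) = (if int K dvd n then real K else 0)" by simp
  then show ?thesis by (simp add: wl)
qed

text \<open>Each further unit of shift drops the term \<open>g a\<close> and gains the equal term
  \<open>g (K + a)\<close>.\<close>

lemma sum_periodic_shift:
  fixes g :: "nat \<Rightarrow> real"
  assumes "\<And>s. g (s + K) = g s"
  shows "(\<Sum>s<K. g (s + a)) = (\<Sum>s<K. g s)"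
proof (induction a)
  case (Suc a)
  have "(\<Sum>s<K. g (s + Suc a)) + g a = (\<Sum>s<K. g (s + a)) + g (K + a)"
    using sum.lessThan_Suc_shift [of "\<lambda>s. g (s + a)" K] by simp
  then show ?case using Suc assms [of a] by (simp add: add.commute)
qed simp

text \<open>If \<open>w j k\<close> is the inner product of \<open>y j\<close> and
  \<open>y k\<close>, this is the squared norm of the \<open>l\<close>-th discrete Fourier
  coefficient of \<open>y\<close>, divided by \<open>K\<close>. The double sum over a kernel avoids
  complex vectors.\<close>

definition power_spectrum :: "nat \<Rightarrow> (nat \<Rightarrow> nat \<Rightarrow> real) \<Rightarrow> nat \<Rightarrow> real" where
  "power_spectrum K w l =
     (\<Sum>j<K. \<Sum>k<K. w j k * cos (2 * pi * real l * (real j - real k) / real K)) / real K"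

text \<open>A discrete Wiener-Khinchin identity: orthogonality of the cosines leaves only the pairs
  \<open>j\<close>, \<open>k\<close> whose difference is congruent to \<open>b - a\<close> or
  \<open>a - b\<close> modulo \<open>K\<close>, and by symmetry of \<open>w\<close> both kinds
  contribute the same.\<close>

lemma autocorrelation_eq_power_spectrum:
  fixes w :: "nat \<Rightarrow> nat \<Rightarrow> real"
  assumes "K > 0" and per: "\<And>j k. w (j + K) k = w j k" and sym: "\<And>j k. w j k = w k j"
  shows "(\<Sum>l<K. power_spectrum K w l * cos (2 * pi * real l * (real a - real b) / real K))
    = (\<Sum>s<K. w (s + a) (s + b))"
proof -
  let ?D = "\<lambda>j k. if int K dvd int j - int k then 1 else 0 :: real"
  have per2: "w j (k + K) = w j k" for j k using per sym by metis
  have D: "?D (j + K) k = ?D j k" "?D j (k + K) = ?D j k" for j k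
  proof -
    have "int K dvd int (j + K) - int k \<longleftrightarrow> int K dvd int j - int k"
      using dvd_add_left_iff [of "int K" "int K" "int j - int k"] by (simp add: algebra_simps)
    moreover have "int K dvd int j - int (k + K) \<longleftrightarrow> int K dvd int j - int k"
      using dvd_diff_left_iff [of "int K" "int K" "int j - int k"] by (simp add: algebra_simps)
    ultimately show "?D (j + K) k = ?D j k" "?D j (k + K) = ?D j k" by simp_all
  qed
  \<comment> \<open>The product-to-sum formula gives two instances of the orthogonality relation,
    one for each sign of \<open>a - b\<close>.\<close>
  have cc: "(\<Sum>l<K. cos (2 * pi * real l * (real j - real k) / real K)
        * cos (2 * pi * real l * (real a - real b) / real K))
      = real K / 2 * (?D (j + a) (k + b) + ?D (k + a) (j + b))" for j k
  proof -
    have "cos (2 * pi * real l * (real j - real k) / real K)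
        * cos (2 * pi * real l * (real a - real b) / real K)
      = (cos (2 * pi * real l * of_int (int (k + a) - int (j + b)) / real K)
        + cos (2 * pi * real l * of_int (int (j + a) - int (k + b)) / real K)) / 2" for l
    proof -
      have 1: "cos (2 * pi * real l * of_int (int (k + a) - int (j + b)) / real K)
        = cos (2 * pi * real l * (real j - real k) / real K - 2 * pi * real l * (real a - real b) / real K)"
        by (subst cos_minus [symmetric], rule arg_cong [where f = cos])
           (simp add: algebra_simps add_divide_distrib diff_divide_distrib)
      have 2: "cos (2 * pi * real l * of_int (int (j + a) - int (k + b)) / real K)
        = cos (2 * pi * real l * (real j - real k) / real K + 2 * pi * real l * (real a - real b) / real K)"
        by (rule arg_cong [where f = cos])
           (simp add: algebra_simps add_divide_distrib diff_divide_distrib)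
      show ?thesis unfolding 1 2 by (rule cos_times_cos)
    qed
    then have "(\<Sum>l<K. cos (2 * pi * real l * (real j - real k) / real K)
        * cos (2 * pi * real l * (real a - real b) / real K))
      = ((\<Sum>l<K. cos (2 * pi * real l * of_int (int (k + a) - int (j + b)) / real K))
        + (\<Sum>l<K. cos (2 * pi * real l * of_int (int (j + a) - int (k + b)) / real K))) / 2"
      by (simp only: sum_divide_distrib [symmetric] sum.distrib [symmetric])
    then show ?thesis
      unfolding sum_cos_multiples [OF \<open>K > 0\<close>] by simp
  qed
  have "(\<Sum>l<K. power_spectrum K w l * cos (2 * pi * real l * (real a - real b) / real K))
    = (\<Sum>j<K. \<Sum>k<K. w j k / K * (\<Sum>l<K. cos (2 * pi * real l * (real j - real k) / real K)
        * cos (2 * pi * real l * (real a - real b) / real K)))"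
    unfolding power_spectrum_def sum_divide_distrib sum_distrib_right sum_distrib_left
    by (subst sum.swap, rule sum.cong [OF refl], subst sum.swap) (simp add: mult_ac)
  also have "\<dots> = (\<Sum>j<K. \<Sum>k<K. w j k * ?D (j + a) (k + b) / 2)
      + (\<Sum>j<K. \<Sum>k<K. w j k * ?D (k + a) (j + b) / 2)"
    unfolding cc sum.distrib [symmetric] using \<open>K > 0\<close>
    by (intro sum.cong refl) (simp add: field_simps)
  also have "(\<Sum>j<K. \<Sum>k<K. w j k * ?D (k + a) (j + b) / 2) = (\<Sum>j<K. \<Sum>k<K. w j k * ?D (j + a) (k + b) / 2)"
    by (subst sum.swap) (simp add: sym)
  also have "(\<Sum>j<K. \<Sum>k<K. w j k * ?D (j + a) (k + b) / 2) + (\<Sum>j<K. \<Sum>k<K. w j k * ?D (j + a) (k + b) / 2)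
      = (\<Sum>j<K. \<Sum>k<K. w j k * ?D (j + a) (k + b))"
    by (simp add: sum.distrib [symmetric])
  \<comment> \<open>Shifting \<open>k\<close> by \<open>a\<close> here and \<open>j\<close> by
    \<open>b\<close> in the next equation is allowed because the summands are periodic. Afterwards
    the congruence reads \<open>j = k\<close> modulo \<open>K\<close>, which is equality on
    \<open>{..<K}\<close>.\<close>
  also have "\<dots> = (\<Sum>j<K. \<Sum>k<K. w j (k + a) * ?D (j + a) (k + a + b))"
  proof (rule sum.cong [OF refl])
    fix j
    have "w j (s + K) * ?D (j + a) (s + K + b) = w j s * ?D (j + a) (s + b)" for s
      using per2 [of j s] D(2) [of "j + a" "s + b"] by (simp add: add_ac)
    then show "(\<Sum>k<K. w j k * ?D (j + a) (k + b)) = (\<Sum>k<K. w j (k + a) * ?D (j + a) (k + a + b))"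
      using sum_periodic_shift [of "\<lambda>k. w j k * ?D (j + a) (k + b)" K a] by simp
  qed
  also have "\<dots> = (\<Sum>j<K. \<Sum>k<K. w (j + b) (k + a) * ?D (j + b + a) (k + a + b))"
  proof -
    let ?g = "\<lambda>j. \<Sum>k<K. w j (k + a) * ?D (j + a) (k + a + b)"
    have "?g (s + K) = ?g s" for s
      by (simp only: per D(1) add.commute [of K a] add.assoc [of s K a] flip: add.assoc [of s a K])
    then show ?thesis using sum_periodic_shift [of ?g K b] by simp
  qed
  also have "\<dots> = (\<Sum>j<K. \<Sum>k<K. if k = j then w (j + b) (k + a) else 0)"
  proof (intro sum.cong refl)
    fix j k assume "j \<in> {..<K}" "k \<in> {..<K}"
    then have "int K dvd int j - int k \<longleftrightarrow> k = j"
      using dvd_imp_le_int [of "int j - int k" "int K"]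
      by (cases "j = k") (auto simp: abs_if split: if_splits)
    then show "w (j + b) (k + a) * ?D (j + b + a) (k + a + b) = (if k = j then w (j + b) (k + a) else 0)"
      by (simp add: add_ac)
  qed
  also have "\<dots> = (\<Sum>s<K. w (s + a) (s + b))"
    by (simp add: sym)
  finally show ?thesis .
qed

text \<open>The two angles add up to an integer multiple of \<open>2 * pi\<close>, and the cosine is
  even.\<close>

lemma cos_reflect_frequency:
  assumes "l \<le> K"
  shows "cos (2 * pi * real (K - l) * (real j - real k) / real K)
    = cos (2 * pi * real l * (real j - real k) / real K)"
proof (cases "K = 0")
  case False
  then have eq: "2 * pi * real (K - l) * (real j - real k) / real K
      = - (2 * pi * real l * (real j - real k) / real K) + 2 * pi * of_int (int j - int k)"
    using assms by (simp add: of_nat_diff field_simps)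
  show ?thesis unfolding eq cos_add sin_int_2pin cos_int_2pin by simp
qed simp

lemma power_spectrum_reflect:
  assumes "l \<le> K"
  shows "power_spectrum K w (K - l) = power_spectrum K w l"
  by (simp only: power_spectrum_def cos_reflect_frequency [OF assms])

text \<open>The double sum is the sum of the squared norms of the cosine and sine parts of the
  Fourier coefficient. This is what allows square roots of the spectrum as radii.\<close>

lemma power_spectrum_dot_nonneg: "0 \<le> power_spectrum K (\<lambda>j k. dot I (y j) (y k)) l"
proof -
  let ?t = "\<lambda>j. 2 * pi * real l * real j / real K"
  have c: "cos (2 * pi * real l * (real j - real k) / real K)
      = cos (?t j) * cos (?t k) + sin (?t j) * sin (?t k)" for j k
    by (simp add: right_diff_distrib diff_divide_distrib cos_diff)
  have "(\<Sum>j<K. \<Sum>k<K. dot I (y j) (y k) * cos (2 * pi * real l * (real j - real k) / real K))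
    = dot I (lincomb K (\<lambda>j. cos (?t j)) y) (lincomb K (\<lambda>j. cos (?t j)) y)
      + dot I (lincomb K (\<lambda>j. sin (?t j)) y) (lincomb K (\<lambda>j. sin (?t j)) y)"
    unfolding dot_lincomb_left dot_lincomb_right sum_distrib_left sum.distrib [symmetric] c
    by (intro sum.cong refl) (simp add: algebra_simps dot_commute)
  then show ?thesis
    unfolding power_spectrum_def by (simp add: dot_self_nonneg)
qed

text \<open>At frequency zero the spectrum is a multiple of the squared norm of the sum of the
  points. Centring the cycle removes it, which matches the absence of a constant block among the
  block points.\<close>

lemma power_spectrum_dot_0:
  assumes "\<And>i. i \<in> I \<Longrightarrow> (\<Sum>j<K. y j i) = 0"
  shows "power_spectrum K (\<lambda>j k. dot I (y j) (y k)) 0 = 0"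
proof -
  have "(\<Sum>j<K. \<Sum>k<K. dot I (y j) (y k)) = dot I (lincomb K (\<lambda>_. 1) y) (lincomb K (\<lambda>_. 1) y)"
    by (simp add: dot_lincomb_left dot_lincomb_right dot_commute)
  also have "\<dots> = 0"
    using assms by (simp add: dot_def lincomb_def)
  finally show ?thesis by (simp add: power_spectrum_def)
qed

text \<open>The nonzero frequencies split into a lower half, a middle and an upper half. Reflection
  maps the upper half onto the lower one; the middle is the single frequency \<open>K div 2\<close>
  for even \<open>K\<close> and empty for odd \<open>K\<close>.\<close>

lemma sum_reflect_fold:
  fixes p :: "nat \<Rightarrow> real"
  assumes "K \<ge> 1" and "p 0 = 0" and refl: "\<And>l. l \<le> K \<Longrightarrow> p (K - l) = p l"
  shows "(\<Sum>l<K. p l) = (\<Sum>l=1..(K - 1) div 2. 2 * p l) + (if even K then p (K div 2) else 0)"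
proof -
  let ?h = "(K - 1) div 2"
  have "(\<Sum>l<K. p l) = (\<Sum>l\<in>{1..?h} \<union> {?h<..<K - ?h} \<union> {K - ?h..<K}. p l)"
    by (rule sum.mono_neutral_right) (use assms in \<open>auto simp: Suc_le_eq intro!: gr0I\<close>)
  also have "\<dots> = (\<Sum>l\<in>{1..?h}. p l) + (\<Sum>l\<in>{?h<..<K - ?h}. p l) + (\<Sum>l\<in>{K - ?h..<K}. p l)"
    using assms(1) by (subst sum.union_disjoint; (subst sum.union_disjoint)?) auto
  also have "(\<Sum>l\<in>{K - ?h..<K}. p l) = (\<Sum>l\<in>{1..?h}. p l)"
    by (rule sum.reindex_bij_witness [of _ "\<lambda>l. K - l" "\<lambda>l. K - l"]) (use refl in auto)
  also have "(\<Sum>l\<in>{?h<..<K - ?h}. p l) = (if even K then p (K div 2) else 0)"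
  proof (cases "even K")
    case True
    then have "{?h<..<K - ?h} = {K div 2}" using assms(1) by (auto elim!: evenE)
    with True show ?thesis by simp
  next
    case False
    then have "{?h<..<K - ?h} = {}" by (auto elim!: oddE)
    with False show ?thesis by simp
  qed
  finally show ?thesis by (simp add: sum_distrib_left [symmetric])
qed

section \<open>Gram matrix of the block points\<close>

lemma dot_nth_default:
  assumes "length xs = length ys"
  shows "dot {..<length xs} (nth_default 0 xs) (nth_default 0 ys) = sum_list (map2 (*) xs ys)"
  using assms by (simp add: dot_def sum_list_sum_nth nth_default_nth atLeast0LessThan)

text \<open>Each planar block contributes through the addition formula for the cosine of a
  difference. The result has the shape of a folded cosine expansion, ready for comparison with the
  power spectrum.\<close>

lemma dot_block_point:
  assumes "K \<ge> 1"
  shows "dot {..<K - 1} (block_point K \<nu> a) (block_point K \<nu> b)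
    = (\<Sum>l=1..(K - 1) div 2. (\<nu> l)\<^sup>2 * cos (2 * pi * real l * (real a - real b) / real K))
      + (if even K then (\<nu> (K div 2))\<^sup>2 * (-1) ^ (a + b) else 0)"
proof -
  let ?c = "\<lambda>k l. \<nu> l * cos (real k * (2 * pi * real l / real K))"
  let ?s = "\<lambda>k l. \<nu> l * sin (real k * (2 * pi * real l / real K))"
  have len: "length (concat (map (\<lambda>l. [f l, g l]) xs)) = 2 * length xs" for f g :: "nat \<Rightarrow> real" and xs
    by (induction xs) auto
  have pairs: "sum_list (map2 (*) (concat (map (\<lambda>l. [?c a l, ?s a l]) xs)) (concat (map (\<lambda>l. [?c b l, ?s b l]) xs)))
      = (\<Sum>l\<leftarrow>xs. (\<nu> l)\<^sup>2 * cos (2 * pi * real l * (real a - real b) / real K))" for xs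
  proof (induction xs)
    case (Cons l xs)
    have "cos (2 * pi * real l * (real a - real b) / real K)
      = cos (real a * (2 * pi * real l / real K) - real b * (2 * pi * real l / real K))"
      by (simp add: algebra_simps diff_divide_distrib)
    with Cons show ?case by (simp add: cos_diff algebra_simps power2_eq_square)
  qed simp
  have "dot {..<K - 1} (block_point K \<nu> a) (block_point K \<nu> b)
      = sum_list (map2 (*) (block_list K \<nu> a) (block_list K \<nu> b))"
    using dot_nth_default [of "block_list K \<nu> a" "block_list K \<nu> b"] assms
    by (simp add: block_point_def length_block_list)
  also have "\<dots> = (\<Sum>l\<leftarrow>[1..<Suc ((K - 1) div 2)]. (\<nu> l)\<^sup>2 * cos (2 * pi * real l * (real a - real b) / real K))
      + (if even K then (\<nu> (K div 2))\<^sup>2 * (-1) ^ (a + b) else 0)"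
    unfolding block_list_def
    by (subst zip_append)
       (simp_all only: len map_append sum_list.append pairs,
         simp add: power_add power2_eq_square mult_ac)
  also have "(\<Sum>l\<leftarrow>[1..<Suc ((K - 1) div 2)]. (\<nu> l)\<^sup>2 * cos (2 * pi * real l * (real a - real b) / real K))
      = (\<Sum>l=1..(K - 1) div 2. (\<nu> l)\<^sup>2 * cos (2 * pi * real l * (real a - real b) / real K))"
    by (simp add: sum_list_distinct_conv_sum_set atLeastLessThanSuc_atLeastAtMost del: upt_Suc)
  finally show ?thesis .
qed

text \<open>The summed inner products have a cosine expansion whose coefficients are the power
  spectrum: nonnegative, zero at frequency zero and invariant under reflection. Folding it leaves
  exactly the frequencies that occur in the blocks.\<close>

lemma exists_block_points_with_gram:
  fixes y :: "nat \<Rightarrow> 'i \<Rightarrow> real"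
  assumes K: "K \<ge> 1" and per: "\<And>t. y (t + K) = y t"
    and mean: "\<And>i. i \<in> I \<Longrightarrow> (\<Sum>j<K. y j i) = 0"
  obtains \<nu> where "\<And>l. 0 \<le> \<nu> l"
    "\<And>a b. dot {..<K - 1} (block_point K \<nu> a) (block_point K \<nu> b) = (\<Sum>s<K. dot I (y (s + a)) (y (s + b)))"
proof -
  let ?w = "\<lambda>j k. dot I (y j) (y k)"
  define P where "P = power_spectrum K ?w"
  \<comment> \<open>The frequencies \<open>l\<close> and \<open>K - l\<close> share one block, so
    its squared radius is \<open>2 * P l\<close>; only \<open>l = K / 2\<close> is its own
    reflection and counts once.\<close>
  define \<nu> where "\<nu> l = (if 2 * l = K then sqrt (P l) else sqrt (2 * P l))" for l
  have P0: "0 \<le> P l" for l by (simp add: P_def power_spectrum_dot_nonneg)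
  have "dot {..<K - 1} (block_point K \<nu> a) (block_point K \<nu> b) = (\<Sum>s<K. dot I (y (s + a)) (y (s + b)))" for a b
  proof -
    let ?c = "\<lambda>l. cos (2 * pi * real l * (real a - real b) / real K)"
    have "(\<Sum>s<K. dot I (y (s + a)) (y (s + b))) = (\<Sum>l<K. P l * ?c l)"
      using autocorrelation_eq_power_spectrum [of K ?w a b] K per
      by (simp add: P_def dot_commute)
    also have "\<dots> = (\<Sum>l=1..(K - 1) div 2. 2 * (P l * ?c l)) + (if even K then P (K div 2) * ?c (K div 2) else 0)"
    proof (rule sum_reflect_fold [OF K])
      show "P 0 * ?c 0 = 0" using mean by (simp add: P_def power_spectrum_dot_0)
      show "P (K - l) * ?c (K - l) = P l * ?c l" if "l \<le> K" for l
      proof -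
        have "?c (K - l) = ?c l" using that by (rule cos_reflect_frequency)
        then show ?thesis using power_spectrum_reflect [OF that] by (simp add: P_def)
      qed
    qed
    also have "(\<Sum>l=1..(K - 1) div 2. 2 * (P l * ?c l)) = (\<Sum>l=1..(K - 1) div 2. (\<nu> l)\<^sup>2 * ?c l)"
      by (intro sum.cong refl) (use P0 K in \<open>auto simp: \<nu>_def\<close>)
    also have "(if even K then P (K div 2) * ?c (K div 2) else 0)
        = (if even K then (\<nu> (K div 2))\<^sup>2 * (-1) ^ (a + b) else 0)"
    proof (cases "even K")
      case True
      then have "2 * pi * real (K div 2) * (real a - real b) / real K = pi * of_nat a - pi * of_nat b"
        using K by (auto simp: field_simps elim!: evenE)
      then have "?c (K div 2) = (-1) ^ (a + b)"
        by (simp add: cos_diff cos_npi2 sin_npi2 power_add)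
      with True P0 show ?thesis by (simp add: \<nu>_def)
    qed simp
    finally show ?thesis using dot_block_point [OF K, of \<nu> a b] by simp
  qed
  then show thesis using that [of \<nu>] P0 by (simp add: \<nu>_def)
qed

section \<open>Symmetrising a given cycle\<close>

lemma smooth_strongly_convexD:
  assumes "f \<in> smooth_strongly_convex \<mu> L d" "x \<in> Rn d" "y \<in> Rn d"
  shows "f x \<le> f y + dot {..<d} (gradient d f y) (\<lambda>i. x i - y i)
      + L / 2 * dot {..<d} (\<lambda>i. x i - y i) (\<lambda>i. x i - y i)"
    and "f x \<ge> f y + dot {..<d} (gradient d f y) (\<lambda>i. x i - y i)
      + \<mu> / 2 * dot {..<d} (\<lambda>i. x i - y i) (\<lambda>i. x i - y i)"
  using assms unfolding smooth_strongly_convex_def inner_Rn_eq_dot norm_Rn_power2 by blast+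

text \<open>\<open>F\<close> is a sum of copies of \<open>f\<close>, each translated by
  \<open>c\<close> and acting on its own block of \<open>U\<close>; inner products over pairs split
  along these blocks, so the bounds for \<open>f\<close> add up. \<open>A\<close> cuts each block
  off at \<open>d\<close>, so that it lies in \<open>Rn d\<close> for every \<open>U\<close> and the
  bounds hold for all \<open>u\<close> and \<open>v\<close>.\<close>

lemma sum_of_translates_bounds:
  fixes f :: "(nat \<Rightarrow> real) \<Rightarrow> real" and c :: "nat \<Rightarrow> real" and d K :: nat
  defines "A \<equiv> \<lambda>U s i. if i < d then c i + U (s, i) else (0::real)"
  defines "F \<equiv> \<lambda>U. \<Sum>s<K. f (A U s)"
  defines "G \<equiv> \<lambda>U (s, i). gradient d f (A U s) i"
  assumes f: "f \<in> smooth_strongly_convex \<mu> L d"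
  shows "F u \<le> F v + dot ({..<K} \<times> {..<d}) (G v) (\<lambda>i. u i - v i)
        + L / 2 * dot ({..<K} \<times> {..<d}) (\<lambda>i. u i - v i) (\<lambda>i. u i - v i)"
    and "F u \<ge> F v + dot ({..<K} \<times> {..<d}) (G v) (\<lambda>i. u i - v i)
        + \<mu> / 2 * dot ({..<K} \<times> {..<d}) (\<lambda>i. u i - v i) (\<lambda>i. u i - v i)"
proof -
  let ?e = "\<lambda>s i. u (s, i) - v (s, i)"
  have A: "A U s \<in> Rn d" for U s
    by (simp add: A_def topspace_Euclidean_space)
  have dA: "dot {..<d} w (\<lambda>i. A u s i - A v s i) = dot {..<d} w (?e s)" for w s
    by (rule dot_cong) (auto simp: A_def)
  have dA2: "dot {..<d} (\<lambda>i. A u s i - A v s i) w = dot {..<d} (?e s) w" for w s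
    by (rule dot_cong) (auto simp: A_def)
  have dG: "dot ({..<K} \<times> {..<d}) (G v) (\<lambda>i. u i - v i) = (\<Sum>s<K. dot {..<d} (gradient d f (A v s)) (?e s))"
    by (auto simp: dot_def G_def sum.cartesian_product intro!: sum.cong)
  have dd: "dot ({..<K} \<times> {..<d}) (\<lambda>i. u i - v i) (\<lambda>i. u i - v i) = (\<Sum>s<K. dot {..<d} (?e s) (?e s))"
    by (simp add: dot_def sum.cartesian_product case_prod_unfold)
  have "f (A u s) \<le> f (A v s) + dot {..<d} (gradient d f (A v s)) (?e s) + L / 2 * dot {..<d} (?e s) (?e s)"
    and "f (A u s) \<ge> f (A v s) + dot {..<d} (gradient d f (A v s)) (?e s) + \<mu> / 2 * dot {..<d} (?e s) (?e s)"
    for s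
    using smooth_strongly_convexD [OF f A [of u s] A [of v s]] by (simp_all only: dA dA2)
  then show "F u \<le> F v + dot ({..<K} \<times> {..<d}) (G v) (\<lambda>i. u i - v i)
        + L / 2 * dot ({..<K} \<times> {..<d}) (\<lambda>i. u i - v i) (\<lambda>i. u i - v i)"
    and "F u \<ge> F v + dot ({..<K} \<times> {..<d}) (G v) (\<lambda>i. u i - v i)
        + \<mu> / 2 * dot ({..<K} \<times> {..<d}) (\<lambda>i. u i - v i) (\<lambda>i. u i - v i)"
    unfolding F_def dG dd sum_distrib_left sum.distrib [symmetric] by (auto intro!: sum_mono)
qed

lemma periodic_mod:
  assumes "\<And>t. y (t + K) = y t"
  shows "y (t mod K) = y (t::nat)"
proof -
  have "y (r + q * K) = y r" for r q
  proof (induction q)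
    case (Suc q)
    then show ?case using assms [of "r + q * K"] by (simp add: add_ac)
  qed simp
  then show ?thesis by (metis mod_mult_div_eq mult.commute)
qed

lemma block_point_periodic:
  assumes "K \<ge> 1"
  shows "block_point K \<nu> (t + K) = block_point K \<nu> t"
proof -
  have "block_list K \<nu> (t + K) = block_list K \<nu> t"
  proof -
    have "real (t + K) * (2 * pi * real l / real K) = real t * (2 * pi * real l / real K) + 2 * pi * of_int (int l)"
      for l
      using assms by (simp add: field_simps)
    then have "cos (real (t + K) * (2 * pi * real l / real K)) = cos (real t * (2 * pi * real l / real K))"
      "sin (real (t + K) * (2 * pi * real l / real K)) = sin (real t * (2 * pi * real l / real K))" for l
      by (simp_all add: cos_add sin_add cos_int_2pin sin_int_2pin del: of_int_of_nat_eq of_nat_add)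
    then show ?thesis
      unfolding block_list_def by (simp only: power_add) (simp add: neg_one_even_power)
  qed
  then show ?thesis by (simp add: block_point_def)
qed

text \<open>The length \<open>K\<close> of the given cycle is kept, and its points being not all
  equal yields \<open>K \<ge> 2\<close>. The new points inherit the heavy-ball relation because it
  is a linear relation between gradients and points, which the transfer preserves.\<close>

lemma exists_symmetric_cycle:
  assumes "0 < \<mu>" "\<mu> < L" "\<gamma> \<noteq> 0"
    and f: "f \<in> smooth_strongly_convex \<mu> L d"
    and cyc: "HB_fun_cycles_on \<gamma> \<beta> d f K x"
  shows "K \<ge> 2 \<and> (\<exists>\<nu>. (\<forall>l. 0 \<le> \<nu> l) \<and>
    HB_cycles_on \<gamma> \<beta> (smooth_strongly_convex \<mu> L) (K - 1) K (block_point K \<nu>))"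
proof
  have xR: "\<And>k. k < K \<Longrightarrow> x k \<in> Rn d"
    and HB: "\<And>t. heavy_ball \<gamma> \<beta> d f (x 0) (x 1) t = x (t mod K)"
    using cyc by (auto simp: HB_fun_cycles_on_def)
  obtain a b where ab: "a < K" "b < K" "x a \<noteq> x b"
    using cyc by (auto simp: HB_fun_cycles_on_def)
  then have "a \<noteq> b" by blast
  with ab show K2: "K \<ge> 2" by linarith
  define z where "z t = x (t mod K)" for t
  define c where "c i = (\<Sum>k<K. x k i) / real K" for i
  define y where "y t = (\<lambda>i. z t i - c i)" for t
  define X where "X t = (\<lambda>(s, i). y (s + t) i)" for t
  define I where "I = {..<K} \<times> {..<d}"
  define A where "A U s = (\<lambda>i. if i < d then c i + U (s, i) else (0::real))" for U :: "nat \<times> nat \<Rightarrow> real" and s :: nat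
  define F where "F U = (\<Sum>s<K. f (A U s))" for U
  define G where "G U = (\<lambda>(s, i). gradient d f (A U s) i)" for U
  have K1: "K \<ge> 1" using K2 by simp
  have zR: "z t \<in> Rn d" for t using xR K2 by (simp add: z_def)
  have cR: "c \<in> Rn d" using xR by (auto simp: topspace_Euclidean_space c_def)
  have yper: "y (t + K) = y t" for t by (simp add: y_def z_def)
  have AX: "A (X t) s = z (s + t)" for t s
    using zR [of "s + t"] cR by (auto simp: A_def X_def y_def topspace_Euclidean_space fun_eq_iff)
  have step: "z (Suc (Suc t)) i
      = z (Suc t) i - \<gamma> * gradient d f (z (Suc t)) i + \<beta> * (z (Suc t) i - z t i)" for t i
    using fun_cong [OF heavy_ball.simps(3) [of \<gamma> \<beta> d f "x 0" "x 1" t], of i] by (simp only: HB z_def)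
  \<comment> \<open>The recursion is solved for the gradient. The coefficients
    \<open>1 + \<beta>\<close>, \<open>-1\<close> and \<open>-\<beta>\<close> add up to zero, so the
    mean \<open>c\<close> cancels and \<open>z\<close> may be replaced by \<open>y\<close>.\<close>
  have grad: "gradient d f (z (Suc t)) i = ((1 + \<beta>) * y (Suc t) i - y (Suc (Suc t)) i - \<beta> * y t i) / \<gamma>" for t i
    using step [of t i] \<open>\<gamma> \<noteq> 0\<close> by (simp add: y_def field_simps)
  have mean: "(\<Sum>k<K. y k i) = 0" for i
    using K2 by (simp add: y_def z_def sum_subtractf c_def)
  obtain \<nu> where \<nu>: "\<And>l. 0 \<le> \<nu> l" and gram0: "\<And>a b. dot {..<K - 1} (block_point K \<nu> a) (block_point K \<nu> b)
      = (\<Sum>s<K. dot {..<d} (y (s + a)) (y (s + b)))"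
    using exists_block_points_with_gram [of K y "{..<d}", OF K1 yper mean] by blast
  let ?Y = "block_point K \<nu>"
  have gram: "dot I (X a) (X b) = dot {..<K - 1} (?Y a) (?Y b)" for a b
    unfolding gram0 by (simp add: dot_def I_def X_def sum.cartesian_product case_prod_unfold)
  have YR: "?Y k \<in> Rn (K - 1)" for k
    using K2 by (intro block_point_in_Rn) simp
  have cong: "\<And>i. i \<in> I \<Longrightarrow> G u i = G v i" if "\<And>i. i \<in> I \<Longrightarrow> u i = v i" for u v
  proof -
    have "A u s = A v s" if "s < K" for s
      using \<open>\<And>i. i \<in> I \<Longrightarrow> u i = v i\<close> that by (auto simp: A_def I_def fun_eq_iff)
    then show "\<And>i. i \<in> I \<Longrightarrow> G u i = G v i" by (auto simp: G_def I_def)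
  qed
  note FG = sum_of_translates_bounds [OF f, where c = c and K = K, folded A_def F_def G_def I_def]
  have "\<exists>h \<in> smooth_strongly_convex \<mu> L (K - 1). \<forall>k c. k < K \<longrightarrow> (\<forall>i\<in>I. G (X k) i = lincomb K c X i) \<longrightarrow>
       gradient (K - 1) h (?Y k) = lincomb K c ?Y"
  proof (rule smooth_strongly_convex_transfer [of I \<mu> L K ?Y "K - 1" X G F])
    show "finite I" "0 \<le> \<mu>" "0 < L" "\<mu> \<le> L" using assms(1,2) by (auto simp: I_def)
    show "G u i = G v i" if "\<And>i. i \<in> I \<Longrightarrow> u i = v i" "i \<in> I" for u v i
      using cong that by blast
    show ?thesis if "h \<in> smooth_strongly_convex \<mu> L (K - 1)"
      "\<And>k c. k < K \<Longrightarrow> (\<And>i. i \<in> I \<Longrightarrow> G (X k) i = lincomb K c X i) \<Longrightarrow>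
         gradient (K - 1) h (?Y k) = lincomb K c ?Y" for h
      using that by blast
  qed (rule YR gram FG)+
  then obtain h where h: "h \<in> smooth_strongly_convex \<mu> L (K - 1)"
    and gh: "\<And>k c. k < K \<Longrightarrow> (\<And>i. i \<in> I \<Longrightarrow> G (X k) i = lincomb K c X i) \<Longrightarrow>
       gradient (K - 1) h (?Y k) = lincomb K c ?Y"
    by blast
  have Xper: "X (t + K) = X t" for t
    using yper by (auto simp: X_def fun_eq_iff simp flip: add.assoc)
  have Yper: "?Y (t + K) = ?Y t" for t
    using K2 by (simp add: block_point_periodic)
  have Ystep: "\<gamma> * gradient (K - 1) h (?Y (Suc t)) i
      = (1 + \<beta>) * ?Y (Suc t) i - ?Y (Suc (Suc t)) i - \<beta> * ?Y t i" for t i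
  proof -
    let ?m = "\<lambda>r j. if j = r mod K then 1 else (0::real)"
    \<comment> \<open>Indices are reduced modulo \<open>K\<close> because the transfer only knows
      combinations of the first \<open>K\<close> points. Adding indicators stays correct when
      reduced indices coincide, as those of \<open>t\<close> and \<open>Suc (Suc t)\<close> do for
      \<open>K = 2\<close>.\<close>
    define e where "e j = ((1 + \<beta>) * ?m (Suc t) j - ?m (Suc (Suc t)) j - \<beta> * ?m t j) / \<gamma>" for j
    have lc: "lincomb K e Z i = ((1 + \<beta>) * Z (Suc t) i - Z (Suc (Suc t)) i - \<beta> * Z t i) / \<gamma>"
      if per: "\<And>t. Z (t + K) = Z t" for Z :: "nat \<Rightarrow> 'i \<Rightarrow> real" and i
    proof -
      have Z: "lincomb K (?m r) Z = Z r" for r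
        using K2 lincomb_indicator [of "r mod K" K Z] periodic_mod [of Z K r, OF per] by simp
      have "lincomb K e Z i
        = ((1 + \<beta>) * lincomb K (?m (Suc t)) Z i - lincomb K (?m (Suc (Suc t))) Z i - \<beta> * lincomb K (?m t) Z i) / \<gamma>"
        unfolding lincomb_def e_def sum_distrib_left sum_subtractf [symmetric] sum_divide_distrib
        by (intro sum.cong refl) (simp add: algebra_simps add_divide_distrib diff_divide_distrib)
      then show ?thesis by (simp only: Z)
    qed
    have "G (X (Suc t)) i = lincomb K e X i" for i
    proof -
      obtain s j where i: "i = (s, j)" by (cases i)
      have "G (X (Suc t)) i = gradient d f (z (Suc (s + t))) j"
        by (simp add: i G_def AX)
      then show ?thesis
        unfolding lc [of X, OF Xper] grad by (simp add: i X_def)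
    qed
    then have "gradient (K - 1) h (?Y (Suc t mod K)) = lincomb K e ?Y"
      using gh [of "Suc t mod K" e] K2 periodic_mod [of X K "Suc t", OF Xper] by simp
    then have "gradient (K - 1) h (?Y (Suc t)) i = lincomb K e ?Y i"
      by (simp only: periodic_mod [of ?Y K "Suc t", OF Yper])
    then show ?thesis
      unfolding lc [of ?Y, OF Yper] using \<open>\<gamma> \<noteq> 0\<close> by simp
  qed
  \<comment> \<open>The recursion is of second order, so two consecutive iterates are carried
    through the induction.\<close>
  have orbit: "heavy_ball \<gamma> \<beta> (K - 1) h (?Y 0) (?Y 1) t = ?Y t
      \<and> heavy_ball \<gamma> \<beta> (K - 1) h (?Y 0) (?Y 1) (Suc t) = ?Y (Suc t)" for t
  proof (induction t)
    case (Suc t)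
    have "heavy_ball \<gamma> \<beta> (K - 1) h (?Y 0) (?Y 1) (Suc (Suc t)) i = ?Y (Suc (Suc t)) i" for i
      unfolding heavy_ball.simps(3) conjunct1 [OF Suc.IH] conjunct2 [OF Suc.IH] Ystep
      by (simp only: algebra_simps)
    then have "heavy_ball \<gamma> \<beta> (K - 1) h (?Y 0) (?Y 1) (Suc (Suc t)) = ?Y (Suc (Suc t))"
      by (rule ext)
    with Suc.IH show ?case by (simp only: simp_thms)
  qed simp
  \<comment> \<open>Equal Gram matrices preserve distances, so coinciding block points would force
    \<open>X a\<close> and \<open>X b\<close> to agree on \<open>I\<close>; their block for the
    shift \<open>0\<close> then gives \<open>x a = x b\<close>.\<close>
  have "?Y a \<noteq> ?Y b"
  proof
    assume "?Y a = ?Y b"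
    then have "dot {..<K - 1} (\<lambda>i. ?Y a i - ?Y b i) (\<lambda>i. ?Y a i - ?Y b i) = 0"
      by (simp add: dot_def)
    then have "dot I (\<lambda>i. X a i - X b i) (\<lambda>i. X a i - X b i) = 0"
      by (simp add: dot_linear gram)
    then have "\<forall>i\<in>I. X a i = X b i"
      by (simp add: dot_self_eq_0_iff I_def)
    then have "x a i = x b i" if "i < d" for i
    proof -
      have "X a (0, i) = X b (0, i)"
        using \<open>\<forall>i\<in>I. X a i = X b i\<close> that K2 by (simp add: I_def)
      then show ?thesis using ab by (simp add: X_def y_def z_def)
    qed
    moreover have "x a i = x b i" if "\<not> i < d" for i
      using that ab xR [of a] xR [of b] by (simp add: topspace_Euclidean_space)
    ultimately show False using ab by blast
  qed
  then have "HB_fun_cycles_on \<gamma> \<beta> (K - 1) h K ?Y"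
    unfolding HB_fun_cycles_on_def using YR ab
    by (auto simp: orbit periodic_mod [of ?Y K, OF Yper] simp del: One_nat_def)
  then show "\<exists>\<nu>. (\<forall>l. 0 \<le> \<nu> l) \<and>
      HB_cycles_on \<gamma> \<beta> (smooth_strongly_convex \<mu> L) (K - 1) K (block_point K \<nu>)"
    using h \<nu> unfolding HB_cycles_on_def by blast
qed

theorem proposition6p11:
  fixes \<mu> L \<gamma> \<beta> :: real
  assumes "0 < \<mu>" and "\<mu> < L"
    and "(\<gamma>, \<beta>) \<in> Omega_cv_Q L"
    and "HB_has_cycle \<gamma> \<beta> (smooth_strongly_convex \<mu> L)"
  shows "\<exists>K\<ge>2. \<exists>\<nu> :: nat \<Rightarrow> real. (\<forall>l \<in> {1..K div 2}. 0 \<le> \<nu> l) \<and>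
           HB_cycles_on \<gamma> \<beta> (smooth_strongly_convex \<mu> L) (K - 1) K (block_point K \<nu>)"
proof -
  obtain d K x f where "f \<in> smooth_strongly_convex \<mu> L d" "HB_fun_cycles_on \<gamma> \<beta> d f K x"
    using assms(4) unfolding HB_has_cycle_def HB_cycles_on_def by blast
  moreover have "\<gamma> \<noteq> 0" using assms(3) by (auto simp: Omega_cv_Q_def)
  ultimately have K: "K \<ge> 2 \<and> (\<exists>\<nu>. (\<forall>l. 0 \<le> \<nu> l) \<and>
      HB_cycles_on \<gamma> \<beta> (smooth_strongly_convex \<mu> L) (K - 1) K (block_point K \<nu>))"
    using assms(1,2) by (intro exists_symmetric_cycle)
  then obtain \<nu> where "\<forall>l. 0 \<le> \<nu> l"
    "HB_cycles_on \<gamma> \<beta> (smooth_strongly_convex \<mu> L) (K - 1) K (block_point K \<nu>)"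
    by blast
  with K show ?thesis by (intro exI [of _ K] conjI exI [of _ \<nu>]) auto
qed

end
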